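(* Let $R$ be a semiprime ring with $|\min(R)|<\infty$. Then the following statements are equivalent: 1. $\mathcal{C}_{Z(R)}\subseteq\mathcal{C}_R$. 2. $\mathcal{C}_{Z(R)}\cap\mathfrak{p}=\emptyset$ for all $\mathfrak{p}\in\min(R)$. 3. The map $\rho_{R,\min}:\min(R)\to\min(Z(R))$, $\mathfrak{p}\mapsto\mathfrak{p}\cap Z(R)$, is a well-defined map (i.e. $\mathfrak{p}\cap Z(R)\in\min(Z(R))$ for all $\mathfrak{p}\in\min(R)$).
   Context: Rings are associative with $1$. $Z(R)$ is the centre of $R$. $\mathcal{C}_R$ is the set of regular elements (non-zero-divisors) of $R$, and $\mathcal{C}_{Z(R)}$ is the set of regular elements of the ring $Z(R)$. $\min(R)$ is the set of minimal prime ideals of $R$. A ring is semiprime if the intersection of its prime ideals is zero. *)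

theory Defs
  imports "HOL-Algebra.Algebra"
begin

definition centre :: "('a, 'b) ring_scheme \<Rightarrow> 'a set" where
  "centre R = {z \<in> carrier R. \<forall>x \<in> carrier R. z \<otimes>\<^bsub>R\<^esub> x = x \<otimes>\<^bsub>R\<^esub> z}"

definition centre_ring :: "('a, 'b) ring_scheme \<Rightarrow> ('a, 'b) ring_scheme" where
  "centre_ring R = R\<lparr>carrier := centre R\<rparr>"

text \<open>Regular means neither a left nor a right zero-divisor.\<close>

definition regular_elements :: "('a, 'b) ring_scheme \<Rightarrow> 'a set" where
  "regular_elements R =
     {c \<in> carrier R. \<forall>x \<in> carrier R.
        (c \<otimes>\<^bsub>R\<^esub> x = \<zero>\<^bsub>R\<^esub> \<longrightarrow> x = \<zero>\<^bsub>R\<^esub>) \<and> (x \<otimes>\<^bsub>R\<^esub> c = \<zero>\<^bsub>R\<^esub> \<longrightarrow> x = \<zero>\<^bsub>R\<^esub>)}"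

text \<open>The library's \<^locale>\<open>primeideal\<close> is restricted to commutative rings and is elementwise.
  For noncommutative rings primeness is a condition on products of two-sided ideals; in the
  commutative case the two notions agree (lemma \<open>prime_ideal_iff_primeideal\<close> below).\<close>

definition prime_ideal :: "'a set \<Rightarrow> ('a, 'b) ring_scheme \<Rightarrow> bool" where
  "prime_ideal P R \<longleftrightarrow> ideal P R \<and> P \<noteq> carrier R \<and>
     (\<forall>I J. ideal I R \<longrightarrow> ideal J R \<longrightarrow> I \<cdot>\<^bsub>R\<^esub> J \<subseteq> P \<longrightarrow> I \<subseteq> P \<or> J \<subseteq> P)"

definition min_primes :: "('a, 'b) ring_scheme \<Rightarrow> 'a set set" where
  "min_primes R = {P. prime_ideal P R \<and> (\<forall>Q. prime_ideal Q R \<longrightarrow> Q \<subseteq> P \<longrightarrow> Q = P)}"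

text \<open>The intersection of the prime ideals is taken inside the carrier, so an empty intersection
  is the whole ring.\<close>

definition semiprime_ring :: "('a, 'b) ring_scheme \<Rightarrow> bool" where
  "semiprime_ring R \<longleftrightarrow> carrier R \<inter> \<Inter> {P. prime_ideal P R} = {\<zero>\<^bsub>R\<^esub>}"

lemma (in cring) prime_ideal_iff_primeideal: "prime_ideal P R \<longleftrightarrow> primeideal P R"
proof
  assume P: "prime_ideal P R"
  then have idP: "ideal P R" and ne: "carrier R \<noteq> P" by (auto simp: prime_ideal_def)
  show "primeideal P R"
  proof (rule primeidealI[OF idP is_cring ne])
    fix a b assume a: "a \<in> carrier R" and b: "b \<in> carrier R" and ab: "a \<otimes> b \<in> P"
    have "(PIdl a) \<cdot> (PIdl b) \<subseteq> P"
    proof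
      fix s assume "s \<in> (PIdl a) \<cdot> (PIdl b)"
      then show "s \<in> P"
      proof induct
        case (prod i j)
        then obtain x y where xy: "x \<in> carrier R" "y \<in> carrier R" "i = x \<otimes> a" "j = y \<otimes> b"
          by (auto simp: cgenideal_def)
        then have "i \<otimes> j = (x \<otimes> y) \<otimes> (a \<otimes> b)" using a b by (simp add: m_ac)
        then show ?case using ideal.I_l_closed[OF idP ab] xy by simp
      next
        case (sum s1 s2)
        then show ?case using additive_subgroup.a_closed[OF ideal.axioms(1)[OF idP]] by blast
      qed
    qed
    then have "(PIdl a) \<subseteq> P \<or> (PIdl b) \<subseteq> P"
      using P cgenideal_ideal a b unfolding prime_ideal_def by blast
    then show "a \<in> P \<or> b \<in> P" using cgenideal_self a b by blast
  qed
next
  assume "primeideal P R"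
  then interpret primeideal P R .
  have "I \<subseteq> P \<or> J \<subseteq> P" if I: "ideal I R" and J: "ideal J R" and IJ: "I \<cdot> J \<subseteq> P" for I J
  proof (rule ccontr)
    assume "\<not> ?thesis"
    then obtain i j where ij: "i \<in> I" "i \<notin> P" "j \<in> J" "j \<notin> P" by blast
    then have "i \<otimes> j \<in> P" using IJ ideal_prod.prod[of i I j J R] by blast
    then show False using I_prime ij ideal.Icarr[OF I] ideal.Icarr[OF J] by blast
  qed
  then show "prime_ideal P R"
    unfolding prime_ideal_def using ideal_axioms I_notcarr by blast
qed

lemma cring_centre_ring:
  fixes R (structure)
  assumes "ring R"
  shows "cring (centre_ring R)"
proof -
  interpret ring R by fact
  have carr: "h \<in> carrier R" if "h \<in> centre R" for h
    using that by (simp add: centre_def)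
  have comm: "h \<otimes> x = x \<otimes> h" if "h \<in> centre R" "x \<in> carrier R" for h x
    using that unfolding centre_def by blast
  have centreI: "h \<in> centre R"
    if "h \<in> carrier R" "\<And>x. x \<in> carrier R \<Longrightarrow> h \<otimes> x = x \<otimes> h" for h
    using that unfolding centre_def by blast
  have "subring (centre R) R"
  proof (rule subringI)
    show "centre R \<subseteq> carrier R" using carr by blast
    show "\<one> \<in> centre R" by (rule centreI) simp_all
    fix h assume h: "h \<in> centre R"
    show "\<ominus> h \<in> centre R"
    proof (rule centreI)
      fix x assume x: "x \<in> carrier R"
      show "\<ominus> h \<otimes> x = x \<otimes> \<ominus> h"
        using comm[OF h x] carr[OF h] x by (simp only: l_minus r_minus)
    qed (simp add: carr[OF h])
    fix k assume k: "k \<in> centre R"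
    show "h \<oplus> k \<in> centre R"
    proof (rule centreI)
      fix x assume x: "x \<in> carrier R"
      show "(h \<oplus> k) \<otimes> x = x \<otimes> (h \<oplus> k)"
        using comm[OF h x] comm[OF k x] carr[OF h] carr[OF k] x by (simp only: l_distr r_distr)
    qed (simp add: carr[OF h] carr[OF k])
    show "h \<otimes> k \<in> centre R"
    proof (rule centreI)
      fix x assume x: "x \<in> carrier R"
      show "h \<otimes> k \<otimes> x = x \<otimes> (h \<otimes> k)"
        by (metis comm[OF h x] comm[OF k x] carr[OF h] carr[OF k] x m_assoc)
    qed (simp add: carr[OF h] carr[OF k])
  qed
  then have "subcring (centre R) R"
    by (rule subcringI) (rule comm[OF _ carr])
  then show ?thesis
    unfolding centre_ring_def using subcring_iff[of "centre R"] carr by blast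
qed

end

theory Submission
  imports Defs
begin

text \<open>A finite intersection of ideals lying in a prime forces one of them into it.  So if
  finitely many pairwise incomparable primes intersect in zero, a regular \<open>c\<close> avoids each such
  prime \<open>P\<close>: otherwise \<open>c\<close> kills the intersection of the others, which is then zero and hence
  inside \<open>P\<close>.  Applied to \<open>R\<close> this gives \<open>1 \<Longrightarrow> 2\<close>; applied to the contracted primes
  in \<open>Z(R)\<close> it gives \<open>3 \<Longrightarrow> 2\<close>.  For \<open>2 \<Longrightarrow> 1\<close>, if a central \<open>c\<close> avoids all minimal primes
  and \<open>c x = 0\<close>, then \<open>x\<close> lies in all of them.  For \<open>2 \<Longrightarrow> 3\<close>, an element of \<open>Z(R)\<close> outside the
  minimal members of \<open>{\<pp> \<inter> Z(R)}\<close> is regular in \<open>Z(R)\<close>, so by prime avoidance each \<open>\<pp> \<inter> Z(R)\<close> is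
  such a minimal member, and the minimal members are minimal primes of \<open>Z(R)\<close>.\<close>

section \<open>Ideals, and primes containing a finite intersection of ideals\<close>

lemma prime_idealD:
  assumes "prime_ideal P R"
  shows "ideal P R" "P \<noteq> carrier R"
    "\<And>I J. ideal I R \<Longrightarrow> ideal J R \<Longrightarrow> I \<cdot>\<^bsub>R\<^esub> J \<subseteq> P \<Longrightarrow> I \<subseteq> P \<or> J \<subseteq> P"
  using assms by (auto simp: prime_ideal_def)

lemma ideal_subset_carrier: "ideal I R \<Longrightarrow> I \<subseteq> carrier R"
  using ideal.Icarr by fast

lemma (in ring) ideal_carrier_Inter:
  assumes "\<And>I. I \<in> F \<Longrightarrow> ideal I R"
  shows "ideal (carrier R \<inter> \<Inter>F) R"
proof -
  have "ideal (\<Inter>(insert (carrier R) F)) R"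
    using assms oneideal by (intro i_Intersect) auto
  then show ?thesis by simp
qed

lemma (in ring) ideal_prod_subset:
  assumes P: "ideal P R" and "\<And>i j. i \<in> I \<Longrightarrow> j \<in> J \<Longrightarrow> i \<otimes> j \<in> P"
  shows "I \<cdot> J \<subseteq> P"
proof
  fix s assume "s \<in> I \<cdot> J"
  then show "s \<in> P"
    by induct (use assms additive_subgroup.a_closed[OF ideal.axioms(1)[OF P]] in blast)+
qed

text \<open>By induction on \<open>F\<close>: the product of \<open>I\<close> with the intersection
  of the remaining ideals lies in both, hence in \<open>P\<close>, and primeness selects a factor.
  For empty \<open>F\<close> the intersection is \<open>carrier R\<close>, which the proper ideal
  \<open>P\<close> cannot contain.\<close>

lemma (in ring) prime_ideal_finite_Inter:
  assumes "finite F" and P: "prime_ideal P R"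
    and "\<And>I. I \<in> F \<Longrightarrow> ideal I R" and "carrier R \<inter> \<Inter>F \<subseteq> P"
  shows "\<exists>I\<in>F. I \<subseteq> P"
  using assms(1,3,4)
proof (induction F)
  case empty
  then show ?case
    using prime_idealD(2)[OF P] ideal_subset_carrier[OF prime_idealD(1)[OF P]] by auto
next
  case (insert I F)
  define J where "J = carrier R \<inter> \<Inter>F"
  have I: "ideal I R" and J: "ideal J R"
    using insert.prems(1) ideal_carrier_Inter[of F] unfolding J_def by auto
  have "I \<cdot> J \<subseteq> P"
  proof (rule ideal_prod_subset[OF prime_idealD(1)[OF P]])
    fix i j assume ij: "i \<in> I" "j \<in> J"
    then have "i \<otimes> j \<in> I \<inter> J"
      using ideal.Icarr[OF I] ideal.Icarr[OF J] ideal.I_r_closed[OF I] ideal.I_l_closed[OF J]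
      by blast
    then show "i \<otimes> j \<in> P" using insert.prems(2) unfolding J_def by auto
  qed
  then have "I \<subseteq> P \<or> J \<subseteq> P" by (rule prime_idealD(3)[OF P I J])
  then show ?case using insert unfolding J_def by blast
qed

section \<open>Minimal primes below a given prime\<close>

lemma (in ring) prime_ideal_chain_Inter:
  assumes "C \<noteq> {}" and P: "\<And>P. P \<in> C \<Longrightarrow> prime_ideal P R"
    and chain: "\<And>P Q. P \<in> C \<Longrightarrow> Q \<in> C \<Longrightarrow> P \<subseteq> Q \<or> Q \<subseteq> P"
  shows "prime_ideal (\<Inter>C) R"
  unfolding prime_ideal_def
proof (intro conjI allI impI)
  show "ideal (\<Inter>C) R"
    by (rule i_Intersect[OF prime_idealD(1)[OF P] \<open>C \<noteq> {}\<close>])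
  show "\<Inter>C \<noteq> carrier R"
    using assms(1) prime_idealD(2)[OF P] ideal_subset_carrier[OF prime_idealD(1)[OF P]] by blast
  fix I J assume IJ: "ideal I R" "ideal J R" "I \<cdot> J \<subseteq> \<Inter>C"
  show "I \<subseteq> \<Inter>C \<or> J \<subseteq> \<Inter>C"
  proof (rule ccontr)
    assume "\<not> ?thesis"
    then obtain P Q where PQ: "P \<in> C" "\<not> I \<subseteq> P" "Q \<in> C" "\<not> J \<subseteq> Q" by blast
    \<comment> \<open>The smaller of \<open>P\<close> and \<open>Q\<close> contains neither
      \<open>I\<close> nor \<open>J\<close>.\<close>
    then obtain S where "S \<in> C" "\<not> I \<subseteq> S" "\<not> J \<subseteq> S"
      using chain[of P Q] by (metis subset_trans)
    then show False using prime_idealD(3)[OF P IJ(1,2)] IJ(3) by blast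
  qed
qed

lemma (in ring) min_prime_below:
  assumes P: "prime_ideal P R"
  shows "\<exists>Q\<in>min_primes R. Q \<subseteq> P"
proof -
  define A where "A = {Q. prime_ideal Q R \<and> Q \<subseteq> P}"
  \<comment> \<open>\<open>subset_Zorn_nonempty\<close> yields maximal sets from unions of chains,
    so it is applied to complements: a union of complements is the complement of the intersection,
    and a maximal complement comes from a minimal prime.\<close>
  define K where "K = (\<lambda>Q. carrier R - Q) ` A"
  have sub: "Q \<subseteq> carrier R" if "Q \<in> A" for Q
    using that ideal_subset_carrier prime_idealD(1) unfolding A_def by blast
  have "\<exists>M\<in>K. \<forall>Y\<in>K. M \<subseteq> Y \<longrightarrow> Y = M"
  proof (rule subset_Zorn_nonempty)
    show "K \<noteq> {}" using P unfolding K_def A_def by auto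
    fix C assume C: "C \<noteq> {}" "subset.chain K C"
    then have total: "S \<subseteq> T \<or> T \<subseteq> S" if "S \<in> C" "T \<in> C" for S T
      using that by (simp add: subset_chain_def)
    define D where "D = {Q \<in> A. carrier R - Q \<in> C}"
    have CD: "C = (\<lambda>Q. carrier R - Q) ` D"
      using C(2) unfolding D_def K_def subset_chain_def by blast
    have "D \<noteq> {}" using C(1) CD by auto
    have "prime_ideal (\<Inter>D) R"
    proof (rule prime_ideal_chain_Inter[OF \<open>D \<noteq> {}\<close>])
      show "prime_ideal Q R" if "Q \<in> D" for Q using that unfolding D_def A_def by auto
      show "Q \<subseteq> Q' \<or> Q' \<subseteq> Q" if "Q \<in> D" "Q' \<in> D" for Q Q'
      proof -
        have "carrier R - Q \<subseteq> carrier R - Q' \<or> carrier R - Q' \<subseteq> carrier R - Q"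
          using that by (intro total) (simp_all add: D_def)
        moreover have "Q \<subseteq> carrier R" "Q' \<subseteq> carrier R" using that sub unfolding D_def by simp_all
        ultimately show ?thesis by blast
      qed
    qed
    moreover have "\<Inter>D \<subseteq> P" using \<open>D \<noteq> {}\<close> unfolding D_def A_def by blast
    ultimately have "\<Inter>D \<in> A" unfolding A_def by simp
    moreover have "\<Union>C = carrier R - \<Inter>D" unfolding CD by blast
    ultimately show "\<Union>C \<in> K" unfolding K_def by blast
  qed
  then obtain Q where Q: "Q \<in> A"
    and max: "\<forall>Y\<in>K. carrier R - Q \<subseteq> Y \<longrightarrow> Y = carrier R - Q"
    unfolding K_def by (elim bexE imageE) simp
  have "Q' = Q" if "prime_ideal Q' R" "Q' \<subseteq> Q" for Q'
  proof -
    have "Q' \<in> A" using that Q unfolding A_def by auto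
    then have "carrier R - Q' = carrier R - Q"
      using max that(2) unfolding K_def by (simp add: Diff_mono)
    then show ?thesis using sub[OF Q] sub[OF \<open>Q' \<in> A\<close>] by blast
  qed
  then show ?thesis using Q unfolding min_primes_def A_def by blast
qed

text \<open>Every prime contains a minimal one, so discarding the other primes does not enlarge the
  intersection.\<close>

lemma (in ring) semiprime_Inter_min_primes:
  assumes "semiprime_ring R"
  shows "carrier R \<inter> \<Inter>(min_primes R) = {\<zero>}"
proof -
  have "carrier R \<inter> \<Inter>(min_primes R) = carrier R \<inter> \<Inter>{P. prime_ideal P R}"
    using min_prime_below unfolding min_primes_def by blast
  then show ?thesis using assms unfolding semiprime_ring_def by simp
qed

section \<open>Regular elements and avoidance of finitely many primes\<close>

lemma (in ring) regular_notin_irredundant_prime: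
  assumes "finite F" and P: "\<And>P. P \<in> F \<Longrightarrow> prime_ideal P R"
    and antichain: "\<And>P Q. P \<in> F \<Longrightarrow> Q \<in> F \<Longrightarrow> Q \<subseteq> P \<Longrightarrow> Q = P"
    and zero: "carrier R \<inter> \<Inter>F = {\<zero>}"
    and c: "c \<in> regular_elements R" and "P \<in> F"
  shows "c \<notin> P"
proof
  assume cP: "c \<in> P"
  have idl: "ideal Q R" if "Q \<in> F" for Q using P[OF that] by (rule prime_idealD)
  have "carrier R \<inter> \<Inter>(F - {P}) \<subseteq> P"
  proof
    fix x assume x: "x \<in> carrier R \<inter> \<Inter>(F - {P})"
    have cc: "c \<in> carrier R" using c unfolding regular_elements_def by simp
    \<comment> \<open>For \<open>Q = P\<close> the factor \<open>c\<close> gives membership, for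
      every other \<open>Q\<close> the factor \<open>x\<close> does.\<close>
    have "c \<otimes> x \<in> Q" if "Q \<in> F" for Q
      using ideal.I_r_closed[OF idl[OF that], of c x] ideal.I_l_closed[OF idl[OF that], of x c]
        cP x cc that by blast
    then have "c \<otimes> x = \<zero>" using zero x cc by blast
    then have "x = \<zero>" using c x unfolding regular_elements_def by blast
    then show "x \<in> P" using zero \<open>P \<in> F\<close> by blast
  qed
  then have "\<exists>Q\<in>F - {P}. Q \<subseteq> P"
    using prime_ideal_finite_Inter[of "F - {P}" P] P \<open>P \<in> F\<close> idl \<open>finite F\<close> by blast
  then show False using antichain \<open>P \<in> F\<close> by blast
qed

text \<open>By induction on \<open>F\<close>: if the element \<open>a\<close> that avoids
  \<open>F\<close> lies in the new prime \<open>Q\<close>, it is corrected by some \<open>b\<close>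
  in \<open>I\<close> that lies in all of \<open>F\<close> but not in \<open>Q\<close>. Since primes
  need not be completely prime, \<open>b\<close> is taken from an intersection of ideals and not
  built as a product of elements.\<close>

lemma (in ring) prime_avoidance_antichain:
  assumes "finite F" and I: "ideal I R" and "\<And>P. P \<in> F \<Longrightarrow> prime_ideal P R"
    and "\<And>P Q. P \<in> F \<Longrightarrow> Q \<in> F \<Longrightarrow> Q \<subseteq> P \<Longrightarrow> Q = P"
    and "\<And>P. P \<in> F \<Longrightarrow> \<not> I \<subseteq> P"
  shows "\<exists>a\<in>I. \<forall>P\<in>F. a \<notin> P"
  using assms(1,3-)
proof (induction F)
  case empty
  then show ?case using additive_subgroup.zero_closed[OF ideal.axioms(1)[OF I]] by blast
next
  case (insert Q F)
  have idl: "ideal P R" if "P \<in> insert Q F" for P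
    using insert.prems(1)[OF that] by (rule prime_idealD)
  have "\<exists>a\<in>I. \<forall>P\<in>F. a \<notin> P" using insert.prems by (intro insert.IH) auto
  then obtain a where a: "a \<in> I" "\<And>P. P \<in> F \<Longrightarrow> a \<notin> P" by blast
  \<comment> \<open>Otherwise \<open>Q\<close> contains \<open>I\<close> or a member of
    \<open>F\<close>; the antichain condition excludes the latter.\<close>
  have "\<not> carrier R \<inter> \<Inter>(insert I F) \<subseteq> Q"
  proof
    assume "carrier R \<inter> \<Inter>(insert I F) \<subseteq> Q"
    then have "\<exists>J\<in>insert I F. J \<subseteq> Q"
      using insert.hyps(1) insert.prems(1) idl I by (intro prime_ideal_finite_Inter) auto
    then show False using insert.prems(2)[of Q] insert.prems(3) insert.hyps(2) by blast
  qed
  then obtain b where b: "b \<in> I" "\<And>P. P \<in> F \<Longrightarrow> b \<in> P" "b \<notin> Q" by blast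
  have ab: "a \<in> carrier R" "b \<in> carrier R" using a b ideal.Icarr[OF I] by auto
  show ?case
  proof (cases "a \<in> Q")
    case False
    then show ?thesis using a by blast
  next
    case True
    \<comment> \<open>In \<open>Q\<close>, and in each member of \<open>F\<close>, exactly one of
      \<open>a\<close> and \<open>b\<close> lies, so by these cancellations
      \<open>a \<oplus> b\<close> avoids them all.\<close>
    have mem: "a \<oplus> b \<in> P \<Longrightarrow> a \<in> P \<Longrightarrow> b \<in> P" "a \<oplus> b \<in> P \<Longrightarrow> b \<in> P \<Longrightarrow> a \<in> P"
      if "P \<in> insert Q F" for P
    proof -
      interpret P: ideal P R by (rule idl[OF that])
      show "a \<oplus> b \<in> P \<Longrightarrow> a \<in> P \<Longrightarrow> b \<in> P"
        using P.a_closed[of "\<ominus> a" "a \<oplus> b"] ab by (simp add: r_neg2 r_neg1)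
      show "a \<oplus> b \<in> P \<Longrightarrow> b \<in> P \<Longrightarrow> a \<in> P"
        using P.a_closed[of "a \<oplus> b" "\<ominus> b"] ab by (simp add: a_assoc r_neg)
    qed
    have "a \<oplus> b \<in> I" using a b additive_subgroup.a_closed[OF ideal.axioms(1)[OF I]] by blast
    then show ?thesis using mem True a(2) b(2,3) by blast
  qed
qed

section \<open>The centre and the contraction of primes to it\<close>

lemma carrier_centre_ring [simp]: "carrier (centre_ring R) = centre R"
  and mult_centre_ring [simp]: "x \<otimes>\<^bsub>centre_ring R\<^esub> y = x \<otimes>\<^bsub>R\<^esub> y"
  and add_centre_ring [simp]: "x \<oplus>\<^bsub>centre_ring R\<^esub> y = x \<oplus>\<^bsub>R\<^esub> y"
  and zero_centre_ring [simp]: "\<zero>\<^bsub>centre_ring R\<^esub> = \<zero>\<^bsub>R\<^esub>"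
  and one_centre_ring [simp]: "\<one>\<^bsub>centre_ring R\<^esub> = \<one>\<^bsub>R\<^esub>"
  by (simp_all add: centre_ring_def)

text \<open>Primeness tests only ideals, so two ideals around \<open>c\<close> and \<open>b\<close>
  with product inside \<open>P\<close> are needed. Residuals of \<open>P\<close> serve, which avoids
  describing generated ideals.\<close>

lemma (in ring) prime_ideal_central_mult:
  assumes P: "prime_ideal P R" and c: "c \<in> centre R" and b: "b \<in> carrier R"
    and cb: "c \<otimes> b \<in> P"
  shows "c \<in> P \<or> b \<in> P"
proof -
  interpret P: ideal P R using P by (rule prime_idealD)
  have cc: "c \<in> carrier R" and comm: "\<And>x. x \<in> carrier R \<Longrightarrow> c \<otimes> x = x \<otimes> c"
    using c unfolding centre_def by auto
  \<comment> \<open>\<open>J\<close> is closed under left multiplication because \<open>c\<close> is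
    central; \<open>I\<close> is the largest set whose products with \<open>J\<close> land in
    \<open>P\<close>, so it contains \<open>c\<close> by the choice of \<open>J\<close>.\<close>
  define J where "J = {y \<in> carrier R. c \<otimes> y \<in> P}"
  define I where "I = {y \<in> carrier R. \<forall>z\<in>J. y \<otimes> z \<in> P}"
  have Jc: "z \<in> carrier R" if "z \<in> J" for z using that unfolding J_def by simp
  have Jl: "x \<otimes> z \<in> J" if "z \<in> J" "x \<in> carrier R" for x z
  proof -
    have "c \<otimes> (x \<otimes> z) = x \<otimes> (c \<otimes> z)"
      using that Jc cc comm by (metis m_assoc)
    then show ?thesis using that P.I_l_closed unfolding J_def by simp
  qed
  have J: "ideal J R"
  proof (rule idealI)
    show "subgroup J (add_monoid R)"
      by (rule add.subgroupI)
        (auto simp: J_def r_distr cc r_minus intro!: exI[of _ \<zero>])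
    show "x \<otimes> a \<in> J" if "a \<in> J" "x \<in> carrier R" for a x using Jl that .
    show "a \<otimes> x \<in> J" if "a \<in> J" "x \<in> carrier R" for a x
      using that cc P.I_r_closed[of "c \<otimes> a" x] unfolding J_def by (simp add: m_assoc)
  qed (rule ring_axioms)
  have I: "ideal I R"
  proof (rule idealI)
    show "subgroup I (add_monoid R)"
      by (rule add.subgroupI)
        (auto simp: I_def l_distr Jc l_minus intro!: exI[of _ \<zero>])
    show "x \<otimes> a \<in> I" if "a \<in> I" "x \<in> carrier R" for a x
      using that P.I_l_closed Jc unfolding I_def by (simp add: m_assoc)
    show "a \<otimes> x \<in> I" if "a \<in> I" "x \<in> carrier R" for a x
      using that Jl Jc unfolding I_def by (simp add: m_assoc)
  qed (rule ring_axioms)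
  have "I \<cdot> J \<subseteq> P"
    by (rule ideal_prod_subset[OF P.ideal_axioms]) (simp add: I_def)
  then have "I \<subseteq> P \<or> J \<subseteq> P" by (rule prime_idealD(3)[OF P I J])
  moreover have "c \<in> I" "b \<in> J" using cc b cb unfolding I_def J_def by auto
  ultimately show ?thesis by blast
qed

text \<open>The centre is commutative, so elementwise primeness suffices, and
  \<open>prime_ideal_central_mult\<close> provides it.\<close>

lemma (in ring) prime_ideal_Int_centre:
  assumes P: "prime_ideal P R"
  shows "prime_ideal (P \<inter> centre R) (centre_ring R)"
proof -
  interpret P: ideal P R using P by (rule prime_idealD)
  interpret Z: cring "centre_ring R" by (rule cring_centre_ring[OF ring_axioms])
  have sub: "x \<in> carrier R" if "x \<in> centre R" for x using that unfolding centre_def by simp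
  \<comment> \<open>The negative in \<open>centre_ring R\<close> is defined relative to its own
    carrier; uniqueness of inverses identifies it with the one in \<open>R\<close>.\<close>
  have minus: "\<ominus>\<^bsub>centre_ring R\<^esub> x = \<ominus> x" if "x \<in> centre R" for x
  proof (rule minus_equality[symmetric])
    show "\<ominus>\<^bsub>centre_ring R\<^esub> x \<oplus> x = \<zero>" using Z.l_neg[of x] that by simp
    show "x \<in> carrier R" using that by (rule sub)
    show "\<ominus>\<^bsub>centre_ring R\<^esub> x \<in> carrier R" using Z.a_inv_closed[of x] that by (simp add: sub)
  qed
  have idl: "ideal (P \<inter> centre R) (centre_ring R)"
  proof (rule idealI)
    show "subgroup (P \<inter> centre R) (add_monoid (centre_ring R))"
    proof (rule Z.add.subgroupI)
      show "P \<inter> centre R \<noteq> {}"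
        using additive_subgroup.zero_closed[OF P.additive_subgroup_axioms] Z.zero_closed
        unfolding zero_centre_ring carrier_centre_ring by blast
      show "\<ominus>\<^bsub>centre_ring R\<^esub> a \<in> P \<inter> centre R" if "a \<in> P \<inter> centre R" for a
        using that Z.a_inv_closed[of a] minus[of a]
          additive_subgroup.a_inv_closed[OF P.additive_subgroup_axioms, of a]
        by simp
      show "a \<oplus>\<^bsub>centre_ring R\<^esub> b \<in> P \<inter> centre R"
        if "a \<in> P \<inter> centre R" "b \<in> P \<inter> centre R" for a b
        using that Z.a_closed[of a b] P.a_closed[of a b] by simp
    qed auto
    show "x \<otimes>\<^bsub>centre_ring R\<^esub> a \<in> P \<inter> centre R"
      if "a \<in> P \<inter> centre R" "x \<in> carrier (centre_ring R)" for a x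
      using that Z.m_closed[of x a] P.I_l_closed[of a x] sub by simp
    show "a \<otimes>\<^bsub>centre_ring R\<^esub> x \<in> P \<inter> centre R"
      if "a \<in> P \<inter> centre R" "x \<in> carrier (centre_ring R)" for a x
      using that Z.m_closed[of a x] P.I_r_closed[of a x] sub by simp
  qed (rule Z.ring_axioms)
  have "primeideal (P \<inter> centre R) (centre_ring R)"
  proof (rule primeidealI[OF idl Z.is_cring])
    show "carrier (centre_ring R) \<noteq> P \<inter> centre R"
      using Z.one_closed P.one_imp_carrier prime_idealD(2)[OF P] by auto
    show "a \<in> P \<inter> centre R \<or> b \<in> P \<inter> centre R"
      if "a \<in> carrier (centre_ring R)" "b \<in> carrier (centre_ring R)"
        "a \<otimes>\<^bsub>centre_ring R\<^esub> b \<in> P \<inter> centre R" for a b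
      using that prime_ideal_central_mult[OF P, of a b] sub by auto
  qed
  then show ?thesis by (simp add: Z.prime_ideal_iff_primeideal)
qed

text \<open>Centrality of \<open>c\<close> enters twice: it permits
  \<open>prime_ideal_central_mult\<close>, and it reduces right multiplication by \<open>c\<close>
  to left multiplication.\<close>

lemma (in ring) regular_if_notin_primes:
  assumes P: "\<And>P. P \<in> F \<Longrightarrow> prime_ideal P R" and zero: "carrier R \<inter> \<Inter>F = {\<zero>}"
    and c: "c \<in> centre R" and notin: "\<And>P. P \<in> F \<Longrightarrow> c \<notin> P"
  shows "c \<in> regular_elements R"
proof -
  have cc: "c \<in> carrier R" and comm: "\<And>x. x \<in> carrier R \<Longrightarrow> x \<otimes> c = c \<otimes> x"
    using c unfolding centre_def by auto
  have "x = \<zero>" if "x \<in> carrier R" "c \<otimes> x = \<zero>" for x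
  proof -
    have "x \<in> P" if "P \<in> F" for P
      using prime_ideal_central_mult[OF P[OF that] c \<open>x \<in> carrier R\<close>] notin[OF that] zero that
        \<open>c \<otimes> x = \<zero>\<close> by auto
    then show ?thesis using zero that(1) by blast
  qed
  then show ?thesis using cc comm unfolding regular_elements_def by auto
qed

lemma (in cring) centre_eq_carrier: "centre R = carrier R"
  unfolding centre_def using m_comm by auto

lemma (in cring) prime_without_regulars_minimal:
  assumes "finite F" and P: "\<And>P. P \<in> F \<Longrightarrow> prime_ideal P R"
    and zero: "carrier R \<inter> \<Inter>F = {\<zero>}"
    and "P \<in> F" and noreg: "regular_elements R \<inter> P = {}"
  shows "P \<in> min_primes R"
proof -
  \<comment> \<open>Members of \<open>F\<close> may be comparable, while avoidance needs an
    antichain. As \<open>F\<close> is finite, its minimal members still intersect in zero.\<close>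
  define G where "G = {Q \<in> F. \<forall>Q'\<in>F. Q' \<subseteq> Q \<longrightarrow> Q' = Q}"
  have GF: "G \<subseteq> F" and fin: "finite G" using \<open>finite F\<close> unfolding G_def by auto
  have below: "\<exists>Q'\<in>G. Q' \<subseteq> Q" if "Q \<in> F" for Q
    using finite_has_minimal2[OF \<open>finite F\<close> that] unfolding G_def by blast
  have zeroG: "carrier R \<inter> \<Inter>G = {\<zero>}" using zero below GF by blast
  have PG: "prime_ideal Q R" if "Q \<in> G" for Q using that GF P by blast
  \<comment> \<open>Otherwise avoidance gives an element of \<open>P\<close> outside all of
    \<open>G\<close>, which is then regular. Once \<open>P\<close> lies in some \<open>Q\<close> of
    \<open>G\<close>, minimality of \<open>Q\<close> in \<open>F\<close> gives
    \<open>P = Q\<close>.\<close>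
  have "\<exists>Q\<in>G. P \<subseteq> Q"
  proof (rule ccontr)
    assume "\<not> ?thesis"
    then have "\<exists>a\<in>P. \<forall>Q\<in>G. a \<notin> Q"
      using prime_idealD(1)[OF P[OF \<open>P \<in> F\<close>]] PG fin
      by (intro prime_avoidance_antichain) (auto simp: G_def)
    then obtain a where a: "a \<in> P" "\<And>Q. Q \<in> G \<Longrightarrow> a \<notin> Q" by blast
    have "a \<in> centre R"
      using a(1) ideal.Icarr[OF prime_idealD(1)[OF P[OF \<open>P \<in> F\<close>]]] by (simp add: centre_eq_carrier)
    then have "a \<in> regular_elements R" using regular_if_notin_primes[of G] PG zeroG a(2) by blast
    then show False using noreg a(1) by blast
  qed
  then have "P \<in> G" using \<open>P \<in> F\<close> unfolding G_def by blast
  have "Q = P" if Q: "prime_ideal Q R" "Q \<subseteq> P" for Q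
  proof -
    \<comment> \<open>The zero intersection lies in any prime \<open>Q\<close>, so some
      \<open>S\<close> in \<open>G\<close> lies below \<open>Q\<close>, hence below
      \<open>P\<close>; minimality of \<open>P\<close> in \<open>F\<close> squeezes \<open>Q\<close>
      to \<open>P\<close>.\<close>
    have "carrier R \<inter> \<Inter>G \<subseteq> Q"
      using zeroG additive_subgroup.zero_closed[OF ideal.axioms(1)[OF prime_idealD(1)[OF Q(1)]]]
      by simp
    then have "\<exists>S\<in>G. S \<subseteq> Q"
      using prime_ideal_finite_Inter[OF fin Q(1)] prime_idealD(1)[OF PG] by blast
    then show ?thesis using \<open>P \<in> G\<close> Q(2) GF unfolding G_def by blast
  qed
  then show ?thesis using PG[OF \<open>P \<in> G\<close>] unfolding min_primes_def by blast
qed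

theorem proposition1p8:
  fixes R :: "('a, 'b) ring_scheme"
  assumes "ring R" and "semiprime_ring R" and "finite (min_primes R)"
  shows "(regular_elements (centre_ring R) \<subseteq> regular_elements R
            \<longleftrightarrow> (\<forall>\<pp> \<in> min_primes R. regular_elements (centre_ring R) \<inter> \<pp> = {}))
       \<and> ((\<forall>\<pp> \<in> min_primes R. regular_elements (centre_ring R) \<inter> \<pp> = {})
            \<longleftrightarrow> (\<lambda>\<pp>. \<pp> \<inter> centre R) \<in> min_primes R \<rightarrow> min_primes (centre_ring R))"
proof -
  interpret ring R by fact
  interpret Z: cring "centre_ring R" by (rule cring_centre_ring[OF ring_axioms])
  let ?Z = "centre_ring R"
  define F where "F = (\<lambda>\<pp>. \<pp> \<inter> centre R) ` min_primes R"
  have prime: "prime_ideal P R" if "P \<in> min_primes R" for P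
    using that unfolding min_primes_def by simp
  have zero: "carrier R \<inter> \<Inter>(min_primes R) = {\<zero>\<^bsub>R\<^esub>}"
    by (rule semiprime_Inter_min_primes[OF assms(2)])
  have finF: "finite F" using assms(3) unfolding F_def by simp
  have primeF: "prime_ideal P ?Z" if "P \<in> F" for P
    using that prime prime_ideal_Int_centre unfolding F_def by blast
  have "centre R \<subseteq> carrier R" "\<zero>\<^bsub>R\<^esub> \<in> centre R"
    using Z.zero_closed unfolding centre_def by auto
  then have zeroF: "carrier ?Z \<inter> \<Inter>F = {\<zero>\<^bsub>?Z\<^esub>}" using zero unfolding F_def by auto
  have regc: "regular_elements ?Z \<subseteq> centre R" unfolding regular_elements_def by auto
  show ?thesis
  proof (intro conjI iffI)
    assume sub: "regular_elements ?Z \<subseteq> regular_elements R"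
    show "\<forall>\<pp>\<in>min_primes R. regular_elements ?Z \<inter> \<pp> = {}"
      using regular_notin_irredundant_prime[OF assms(3) prime _ zero] sub
      unfolding min_primes_def by blast
  next
    assume "\<forall>\<pp>\<in>min_primes R. regular_elements ?Z \<inter> \<pp> = {}"
    then show "regular_elements ?Z \<subseteq> regular_elements R"
      using regular_if_notin_primes[OF prime zero] regc by blast
  next
    assume avoid: "\<forall>\<pp>\<in>min_primes R. regular_elements ?Z \<inter> \<pp> = {}"
    show "(\<lambda>\<pp>. \<pp> \<inter> centre R) \<in> min_primes R \<rightarrow> min_primes ?Z"
    proof
      fix \<pp> assume p: "\<pp> \<in> min_primes R"
      show "\<pp> \<inter> centre R \<in> min_primes ?Z"
        using p avoid
        by (intro Z.prime_without_regulars_minimal[OF finF primeF zeroF]) (auto simp: F_def)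
    qed
  next
    assume "(\<lambda>\<pp>. \<pp> \<inter> centre R) \<in> min_primes R \<rightarrow> min_primes ?Z"
    then have "F \<subseteq> min_primes ?Z" unfolding F_def by auto
    \<comment> \<open>Minimal primes are pairwise incomparable, so \<open>F\<close> inherits the
      antichain condition.\<close>
    then have "\<And>P Q. P \<in> F \<Longrightarrow> Q \<in> F \<Longrightarrow> Q \<subseteq> P \<Longrightarrow> Q = P"
      unfolding min_primes_def by blast
    then have "c \<notin> P" if "c \<in> regular_elements ?Z" "P \<in> F" for c P
      using Z.regular_notin_irredundant_prime[OF finF primeF _ zeroF] that by blast
    \<comment> \<open>Regular elements of the centre are central, so missing
      \<open>\<pp> \<inter> centre R\<close> means missing \<open>\<pp>\<close>.\<close>
    then show "\<forall>\<pp>\<in>min_primes R. regular_elements ?Z \<inter> \<pp> = {}"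
      using regc unfolding F_def by blast
  qed
qed

end
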